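(* For every graph $G$ and every positive integer $k$ with $k\equiv 2\pmod 4$, $$\gamma_{\rm sp}(S_k(G)) = \frac{k}{2}\, m(G)+n(G)-\mathrm{ii}(G).$$
   Context: All graphs are finite, simple and undirected. $n(G)$ and $m(G)$ denote the numbers of vertices and edges of $G$. For an integer $k\ge 1$, the $k$-subdivision $S_k(G)$ of $G$ is the graph obtained from $G$ by replacing each edge with a disjoint path of length $k+1$, that is, by subdividing each edge exactly $k$ times. An induced matching in $G$ is a matching $M\subseteq E(G)$ such that the subgraph of $G$ induced by the set $V(M)$ of vertices covered by $M$ contains only the edges of $M$. A matching $M$ is an II-matching if $M$ can be partitioned into two (possibly empty) induced matchings $M_1$ and $M_2$ of $G$. The II-matching number $\mathrm{ii}(G)$ is the maximum size (number of edges) of an II-matching in $G$. For $D\subseteq V(G)$ write $\overline{D}=V(G)\setminus D$, and let $N_G(v)$ be the open neighborhood of $v$. A set $D\subseteq V(G)$ is a dominating set if every vertex of $\overline{D}$ has a neighbor in $D$. A dominating set $D$ is a super dominating set if for every $x\in\overline{D}$ there exists $y\in D$ such that $N_G(y)\cap\overline{D}=\{x\}$. The super domination number $\gamma_{\rm sp}(G)$ is the minimum cardinality of a super dominating set of $G$. *)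

theory Defs
  imports Complex_Main
begin

record 'a graph =
  verts :: "'a set"
  edges :: "'a set set"

definition simple_graph :: "'a graph \<Rightarrow> bool" where
  "simple_graph G \<longleftrightarrow> finite (verts G) \<and> (\<forall>e \<in> edges G. e \<subseteq> verts G \<and> card e = 2)"

definition num_verts :: "'a graph \<Rightarrow> nat" where
  "num_verts G = card (verts G)"

definition num_edges :: "'a graph \<Rightarrow> nat" where
  "num_edges G = card (edges G)"

definition neighborhood :: "'a graph \<Rightarrow> 'a \<Rightarrow> 'a set" where
  "neighborhood G v = {u \<in> verts G. {u, v} \<in> edges G}"

definition induced_subgraph :: "'a graph \<Rightarrow> 'a set \<Rightarrow> 'a graph" where
  "induced_subgraph G S = \<lparr>verts = S, edges = {e \<in> edges G. e \<subseteq> S}\<rparr>"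


subsection \<open>Subdivisions\<close>

text \<open>
  The vertices subdividing an edge \<open>{u, v}\<close> have to be named without orienting the edge:
  \<open>Inner {(u, i), (v, k + 1 - i)}\<close> is the vertex at distance \<open>i\<close> from \<open>u\<close> and
  \<open>k + 1 - i\<close> from \<open>v\<close> on the path that replaces the edge.
\<close>

datatype 'a subdiv_vertex = Orig 'a | Inner "('a \<times> nat) set"

definition subdiv_path :: "nat \<Rightarrow> 'a \<Rightarrow> 'a \<Rightarrow> nat \<Rightarrow> 'a subdiv_vertex" where
  "subdiv_path k u v i =
     (if i = 0 then Orig u
      else if i = k + 1 then Orig v
      else Inner {(u, i), (v, k + 1 - i)})"

definition subdivision :: "nat \<Rightarrow> 'a graph \<Rightarrow> 'a subdiv_vertex graph" where
  "subdivision k G =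
     \<lparr>verts = Orig ` verts G \<union>
        {subdiv_path k u v i | u v i. {u, v} \<in> edges G \<and> 1 \<le> i \<and> i \<le> k},
      edges =
        {{subdiv_path k u v i, subdiv_path k u v (i + 1)} | u v i. {u, v} \<in> edges G \<and> i \<le> k}\<rparr>"

lemma subdiv_path_reverse:
  "i \<le> k + 1 \<Longrightarrow> subdiv_path k v u (k + 1 - i) = subdiv_path k u v i"
  by (auto simp: subdiv_path_def insert_commute)

lemma subdiv_path_inj:
  assumes "u \<noteq> v"
  shows "inj_on (subdiv_path k u v) {0..k + 1}"
  using assms by (auto simp: inj_on_def subdiv_path_def doubleton_eq_iff split: if_splits)

lemma subdiv_path_disjoint:
  assumes "subdiv_path k u v i = subdiv_path k u' v' j" "1 \<le> i" "i \<le> k" "j \<le> k + 1"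
  shows "{u, v} = {u', v'}"
  using assms by (auto simp: subdiv_path_def doubleton_eq_iff split: if_splits)

lemma simple_graph_subdivision:
  assumes "simple_graph G"
  shows "simple_graph (subdivision k G)"
proof -
  have fin: "finite (verts G)" and E: "\<And>u v. {u, v} \<in> edges G \<Longrightarrow> u \<in> verts G \<and> v \<in> verts G \<and> u \<noteq> v"
    using assms by (auto simp: simple_graph_def card_2_iff)
  have "{subdiv_path k u v i | u v i. {u, v} \<in> edges G \<and> 1 \<le> i \<and> i \<le> k}
      \<subseteq> (\<lambda>(u, v, i). subdiv_path k u v i) ` (verts G \<times> verts G \<times> {1..k})"
  proof safe
    fix u v i assume "{u, v} \<in> edges G" "1 \<le> i" "i \<le> k"
    then have "(u, v, i) \<in> verts G \<times> verts G \<times> {1..k}"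
      using E by auto
    then show "subdiv_path k u v i \<in> (\<lambda>(u, v, i). subdiv_path k u v i) ` (verts G \<times> verts G \<times> {1..k})"
      by (rule rev_image_eqI) simp
  qed
  then have "finite {subdiv_path k u v i | u v i. {u, v} \<in> edges G \<and> 1 \<le> i \<and> i \<le> k}"
    by (rule finite_subset) (use fin in auto)
  then have fin': "finite (verts (subdivision k G))"
    using fin by (simp add: subdivision_def)
  have 1: "subdiv_path k u v i \<in> verts (subdivision k G)" if "{u, v} \<in> edges G" "i \<le> k + 1" for u v i
  proof (cases "i = 0 \<or> i = k + 1")
    case True
    then show ?thesis
      using E[OF that(1)] by (auto simp: subdivision_def subdiv_path_def)
  next
    case False
    then have "1 \<le> i" "i \<le> k"
      using that(2) by auto
    then show ?thesis
      using that(1) by (auto simp: subdivision_def)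
  qed
  have 2: "subdiv_path k u v i \<noteq> subdiv_path k u v (i + 1)"
    if "{u, v} \<in> edges G" "i \<le> k" for u v i
    using inj_onD[OF subdiv_path_inj[of u v k], of i "i + 1"] E[OF that(1)] that(2) by auto
  have "e \<subseteq> verts (subdivision k G) \<and> card e = 2" if e: "e \<in> edges (subdivision k G)" for e
  proof -
    obtain u v i where "{u, v} \<in> edges G" "i \<le> k"
      and "e = {subdiv_path k u v i, subdiv_path k u v (i + 1)}"
      using e by (auto simp: subdivision_def)
    then show ?thesis
      using 1[of u v i] 1[of u v "i + 1"] 2[of u v i] by simp
  qed
  then show ?thesis
    using fin' by (simp add: simple_graph_def)
qed


subsection \<open>II-matchings\<close>

definition is_matching :: "'a graph \<Rightarrow> 'a set set \<Rightarrow> bool" where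
  "is_matching G M \<longleftrightarrow> M \<subseteq> edges G \<and> (\<forall>e \<in> M. \<forall>f \<in> M. e \<noteq> f \<longrightarrow> e \<inter> f = {})"

definition induced_matching :: "'a graph \<Rightarrow> 'a set set \<Rightarrow> bool" where
  "induced_matching G M \<longleftrightarrow> is_matching G M \<and> edges (induced_subgraph G (\<Union>M)) = M"

definition II_matching :: "'a graph \<Rightarrow> 'a set set \<Rightarrow> bool" where
  "II_matching G M \<longleftrightarrow> is_matching G M \<and>
     (\<exists>M1 M2. M1 \<union> M2 = M \<and> M1 \<inter> M2 = {} \<and> induced_matching G M1 \<and> induced_matching G M2)"

definition II_matching_number :: "'a graph \<Rightarrow> nat" where
  "II_matching_number G = Max (card ` {M. II_matching G M})"


subsection \<open>Super domination\<close>

definition dominating_set :: "'a graph \<Rightarrow> 'a set \<Rightarrow> bool" where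
  "dominating_set G D \<longleftrightarrow> D \<subseteq> verts G \<and>
     (\<forall>x \<in> verts G - D. neighborhood G x \<inter> D \<noteq> {})"

definition super_dominating_set :: "'a graph \<Rightarrow> 'a set \<Rightarrow> bool" where
  "super_dominating_set G D \<longleftrightarrow> dominating_set G D \<and>
     (\<forall>x \<in> verts G - D. \<exists>y \<in> D. neighborhood G y \<inter> (verts G - D) = {x})"

definition super_domination_number :: "'a graph \<Rightarrow> nat" where
  "super_domination_number G = Min (card ` {D. super_dominating_set G D})"

text \<open>On a finite simple graph, the maximum and the minimum above range over finite nonempty sets.\<close>

lemma II_matching_number_welldefined:
  assumes "simple_graph G"
  shows "finite {M. II_matching G M}" "{M. II_matching G M} \<noteq> {}"
proof -
  have "finite (edges G)"
    using assms by (auto simp: simple_graph_def intro!: finite_subset[of "edges G" "Pow (verts G)"])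
  then show "finite {M. II_matching G M}"
    by (auto simp: II_matching_def is_matching_def intro!: finite_subset[of _ "Pow (edges G)"])
  have "{} \<notin> edges G"
    using assms by (auto simp: simple_graph_def)
  then have "II_matching G {}"
    by (auto simp: II_matching_def induced_matching_def is_matching_def induced_subgraph_def)
  then show "{M. II_matching G M} \<noteq> {}"
    by blast
qed

lemma super_domination_number_welldefined:
  assumes "simple_graph G"
  shows "finite {D. super_dominating_set G D}" "{D. super_dominating_set G D} \<noteq> {}"
proof -
  show "finite {D. super_dominating_set G D}"
    using assms by (auto simp: simple_graph_def super_dominating_set_def dominating_set_def
        intro!: finite_subset[of _ "Pow (verts G)"])
  have "super_dominating_set G (verts G)"
    by (auto simp: super_dominating_set_def dominating_set_def)
  then show "{D. super_dominating_set G D} \<noteq> {}"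
    by blast
qed

end

theory Submission
  imports Defs
begin

text \<open>
  Write \<open>X\<close> for the complement of a super dominating set of the subdivision. Pairing each vertex of
  \<open>X\<close> with a private neighbour outside \<open>X\<close> gives a matching, and two matching edges joined by an
  edge \<open>pq\<close> satisfy \<open>p \<in> X \<longleftrightarrow> q \<in> X\<close>. A path of length \<open>k + 1\<close> replacing an edge of \<open>G\<close> contains at
  most \<open>k / 2 + 1\<close> matching edges. If it contains that many, then the matching is perfect on it, and
  since \<open>k \<equiv> 2 (mod 4)\<close> both of its ends lie in \<open>X\<close> or both lie outside. These full edges form a
  matching \<open>F\<close> of \<open>G\<close>, coloured by membership in \<open>X\<close>. An edge outside \<open>F\<close> between
  two equally coloured vertices of \<open>\<Union>F\<close> carries at most \<open>k / 2 - 1\<close> matching edges, so deleting from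
  \<open>F\<close> one edge for each such deficient edge costs nothing in total and leaves an II-matching. Conversely, an
  II-matching is extended by a pattern of period four along each path.
\<close>


section \<open>Sparse sets of positions and counts for the period-four pattern\<close>

text \<open>The interval has an odd number of positions, so the extremal set without consecutive
  elements is unique. Induction splits off the last two positions, which carry at most one element;
  in the extremal case the even offset just before them is occupied, so the element must be the
  second of the two.\<close>

lemma sparse_card:
  fixes I :: "nat set"
  assumes "I \<subseteq> {a..a + 2 * r}" and "\<And>i. i \<in> I \<Longrightarrow> Suc i \<notin> I"
  shows "card I \<le> Suc r \<and> (card I = Suc r \<longrightarrow> (\<forall>j\<le>r. a + 2 * j \<in> I))"
  using assms
proof (induction r arbitrary: I)
  case 0
  then have "I = {} \<or> I = {a}" by auto
  then show ?case by auto
next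
  case (Suc r)
  let ?J = "I \<inter> {a..a + 2 * r}"
  let ?K = "I \<inter> {a + 2 * r + 1, a + 2 * r + 2}"
  have I: "I = ?J \<union> ?K" and disj: "?J \<inter> ?K = {}"
    using Suc.prems(1) by auto
  have J: "card ?J \<le> Suc r" "card ?J = Suc r \<Longrightarrow> \<forall>j\<le>r. a + 2 * j \<in> ?J"
    using Suc.IH[of ?J] Suc.prems(2) by auto
  have "?K = {} \<or> ?K = {a + 2 * r + 1} \<or> ?K = {a + 2 * r + 2}"
    using Suc.prems(2)[of "a + 2 * r + 1"] by auto
  then have K: "card ?K \<le> 1" by (elim disjE) (simp_all del: Int_insert_right)
  have card: "card I = card ?J + card ?K"
    by (subst I, rule card_Un_disjoint) (use disj in auto)
  have "a + 2 * j \<in> I" if "card I = Suc (Suc r)" "j \<le> Suc r" for j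
  proof -
    have *: "\<forall>j\<le>r. a + 2 * j \<in> I" and "card ?K = 1"
      using J K card that by auto
    then have "?K \<noteq> {}" by fastforce
    moreover have "a + 2 * r + 1 \<notin> I"
      using Suc.prems(2)[of "a + 2 * r"] * by auto
    ultimately have "a + 2 * Suc r \<in> I" by auto
    then show ?thesis
      using * that(2) by (cases "j = Suc r") auto
  qed
  then show ?case using card J(1) K by auto
qed

text \<open>These count the inner vertices put into \<open>X\<close> on a path with
  \<open>k = 4 * t + 2\<close>, for the shifts 0, 2 and 3 of the construction. Every full period
  contributes two, so the shifts differ only through the positions 1 and 2, which contribute none,
  both, or one.\<close>

lemma card_pattern:
  fixes t :: nat
  shows "card {i \<in> {1..4 * t + 2}. i mod 4 \<in> {0, 3}} = 2 * t"
    and "card {i \<in> {1..4 * t + 2}. (i + 2) mod 4 \<in> {0, 3}} = 2 * t + 2"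
    and "card {i \<in> {1..4 * t + 2}. (i + 3) mod 4 \<in> {0, 3}} = 2 * t + 1"
proof -
  have step: "{i \<in> {1..4 * Suc t + 2}. P i} =
      {i \<in> {1..4 * t + 2}. P i} \<union> Set.filter P {4 * t + 3, 4 * t + 4, 4 * t + 5, 4 * t + 6}" for P t
    by auto
  have card: "card {i \<in> {1..4 * Suc t + 2}. P i} = card {i \<in> {1..4 * t + 2}. P i} +
      card (Set.filter P {4 * t + 3, 4 * t + 4, 4 * t + 5, 4 * t + 6})" for P t
    unfolding step by (rule card_Un_disjoint) auto
  have base: "{i \<in> {1..4 * 0 + 2}. P i} = Set.filter P {1, 2 :: nat}" for P
    by auto
  have fins: "Set.filter P (insert x A) = (if P x then insert x (Set.filter P A) else Set.filter P A)"
    "Set.filter P {} = {}" for P and x :: nat and A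
    by auto
  show "card {i \<in> {1..4 * t + 2}. i mod 4 \<in> {0, 3}} = 2 * t"
  proof (induction t)
    case 0 show ?case unfolding base fins by simp
  next
    case (Suc t)
    have "(4 * t + 3) mod 4 = 3" "(4 * t + 4) mod 4 = 0" "(4 * t + 5) mod 4 = 1" "(4 * t + 6) mod 4 = 2"
      by presburger+
    then show ?case unfolding card fins Suc by simp
  qed
  show "card {i \<in> {1..4 * t + 2}. (i + 2) mod 4 \<in> {0, 3}} = 2 * t + 2"
  proof (induction t)
    case 0 show ?case unfolding base fins by simp
  next
    case (Suc t)
    have "(4 * t + 3 + 2) mod 4 = 1" "(4 * t + 4 + 2) mod 4 = 2"
        "(4 * t + 5 + 2) mod 4 = 3" "(4 * t + 6 + 2) mod 4 = 0"
      by presburger+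
    then show ?case unfolding card fins Suc by simp
  qed
  show "card {i \<in> {1..4 * t + 2}. (i + 3) mod 4 \<in> {0, 3}} = 2 * t + 1"
  proof (induction t)
    case 0 show ?case unfolding base fins by simp
  next
    case (Suc t)
    have "(4 * t + 3 + 3) mod 4 = 2" "(4 * t + 4 + 3) mod 4 = 3"
        "(4 * t + 5 + 3) mod 4 = 0" "(4 * t + 6 + 3) mod 4 = 1"
      by presburger+
    then show ?case unfolding card fins Suc by simp
  qed
qed

section \<open>General graphs: complements of super dominating sets and coloured matchings\<close>

lemma finite_edges: "simple_graph G \<Longrightarrow> finite (edges G)"
  by (auto simp: simple_graph_def intro!: finite_subset[of "edges G" "Pow (verts G)"])

text \<open>The vertex \<open>y\<close> supplied for \<open>x\<close> lies outside \<open>X\<close>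
  and is adjacent to \<open>x\<close>, which gives domination.\<close>

lemma super_dominating_set_complI:
  assumes "X \<subseteq> verts G"
    and "\<And>x. x \<in> X \<Longrightarrow> \<exists>y \<in> verts G - X. neighborhood G y \<inter> X = {x}"
  shows "super_dominating_set G (verts G - X)"
proof -
  have X: "verts G - (verts G - X) = X"
    using assms(1) by auto
  have "neighborhood G x \<inter> (verts G - X) \<noteq> {}" if "x \<in> X" for x
  proof -
    obtain y where "y \<in> verts G - X" "x \<in> neighborhood G y"
      using assms(2) \<open>x \<in> X\<close> by blast
    then show ?thesis
      by (auto simp: neighborhood_def insert_commute)
  qed
  then show ?thesis
    unfolding super_dominating_set_def dominating_set_def X using assms(2) by auto
qed

lemma is_matching_subset: "is_matching G F \<Longrightarrow> M \<subseteq> F \<Longrightarrow> is_matching G M"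
  unfolding is_matching_def by blast

text \<open>The edges counted on the right are exactly those that keep the two colour classes of
  \<open>F\<close> from being induced. Deleting one edge of \<open>F\<close> that meets each of them
  leaves an II-matching; several of them may share the deleted edge, hence an inequality.\<close>

lemma matching_le_II_matching_number:
  fixes C :: "'a \<Rightarrow> bool"
  assumes G: "simple_graph G" and F: "is_matching G F"
    and mono: "\<And>e u v. e \<in> F \<Longrightarrow> u \<in> e \<Longrightarrow> v \<in> e \<Longrightarrow> C u = C v"
  shows "card F \<le> II_matching_number G +
    card {e \<in> edges G - F. e \<subseteq> \<Union>F \<and> (\<forall>u\<in>e. \<forall>v\<in>e. C u = C v)}"
    (is "_ \<le> _ + card ?B")
proof -
  define B where "B = ?B"
  have fin: "finite (edges G)"
    using G by (rule finite_edges)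
  have FE: "F \<subseteq> edges G" and disj: "\<And>e f u. e \<in> F \<Longrightarrow> f \<in> F \<Longrightarrow> u \<in> e \<Longrightarrow> u \<in> f \<Longrightarrow> e = f"
    using F by (auto simp: is_matching_def)
  have ne: "e \<noteq> {}" if "e \<in> edges G" for e
    using G that by (auto simp: simple_graph_def)
  have "\<exists>f. f \<in> F \<and> e \<inter> f \<noteq> {}" if B: "e \<in> B" for e
  proof -
    have "e \<noteq> {}" using ne B by (simp add: B_def)
    then obtain u where "u \<in> e" by blast
    then have "u \<in> \<Union>F" using B unfolding B_def by blast
    then show ?thesis using \<open>u \<in> e\<close> by blast
  qed
  then have "\<forall>e\<in>B. \<exists>f. f \<in> F \<and> e \<inter> f \<noteq> {}"
    by (rule ballI)
  then obtain g where "\<forall>e\<in>B. g e \<in> F \<and> e \<inter> g e \<noteq> {}"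
    by (rule bchoice[THEN exE])
  then have g: "\<And>e. e \<in> B \<Longrightarrow> g e \<in> F \<and> e \<inter> g e \<noteq> {}"
    by blast
  define M where "M = F - g ` B"
  have ind: "induced_matching G {e \<in> M. \<forall>u\<in>e. C u = c}" (is "induced_matching G ?M") for c
  proof -
    have "?M \<subseteq> F" by (auto simp: M_def)
    have "e \<in> ?M" if e: "e \<in> edges G" "e \<subseteq> \<Union>?M" for e
    proof -
      have col: "\<forall>u\<in>e. C u = c" using e by blast
      have "e \<in> F"
      proof (rule ccontr)
        assume "e \<notin> F"
        moreover have "e \<subseteq> \<Union>F"
          using e(2) Union_mono[OF \<open>?M \<subseteq> F\<close>] by (rule subset_trans)
        ultimately have B: "e \<in> B"
          using e(1) col by (simp add: B_def)
        \<comment> \<open>The vertex \<open>u\<close> is covered by a surviving edge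
          \<open>f\<close>. Since \<open>F\<close> is a matching, \<open>f\<close> can only be
          \<open>g e\<close>, which was deleted.\<close>
        obtain u where u: "u \<in> e" "u \<in> g e" using g[OF B] by blast
        then obtain f where f: "f \<in> ?M" "u \<in> f" using e by blast
        then have "f = g e" using disj[of f "g e" u] g[OF B] u \<open>?M \<subseteq> F\<close> by blast
        then show False using f(1) B unfolding M_def by blast
      qed
      obtain u where "u \<in> e" using ne e by blast
      then obtain f where f: "f \<in> ?M" "u \<in> f" using e by blast
      then have "f = e" using disj[of f e u] \<open>e \<in> F\<close> \<open>u \<in> e\<close> \<open>?M \<subseteq> F\<close> by blast
      then show ?thesis using f by simp
    qed
    then have "{e \<in> edges G. e \<subseteq> \<Union>?M} \<subseteq> ?M"
      by blast
    moreover have "?M \<subseteq> {e \<in> edges G. e \<subseteq> \<Union>?M}"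
      using \<open>?M \<subseteq> F\<close> FE by blast
    ultimately have "edges (induced_subgraph G (\<Union>?M)) = ?M"
      unfolding induced_subgraph_def graph.simps by (rule subset_antisym)
    moreover have "is_matching G ?M"
      using F \<open>?M \<subseteq> F\<close> by (rule is_matching_subset)
    ultimately show ?thesis unfolding induced_matching_def by blast
  qed
  have "M \<subseteq> F" by (auto simp: M_def)
  have "e \<in> {e \<in> M. \<forall>u\<in>e. C u = True} \<union> {e \<in> M. \<forall>u\<in>e. C u = False}" if "e \<in> M" for e
    using mono[of e] that \<open>M \<subseteq> F\<close> by auto
  then have "{e \<in> M. \<forall>u\<in>e. C u = True} \<union> {e \<in> M. \<forall>u\<in>e. C u = False} = M"
    by blast
  moreover have "{e \<in> M. \<forall>u\<in>e. C u = True} \<inter> {e \<in> M. \<forall>u\<in>e. C u = False} = {}"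
    using ne FE \<open>M \<subseteq> F\<close> by fastforce
  moreover have "is_matching G M"
    using F \<open>M \<subseteq> F\<close> by (rule is_matching_subset)
  ultimately have "II_matching G M"
    unfolding II_matching_def using ind by blast
  then have "card M \<le> II_matching_number G"
    unfolding II_matching_number_def using II_matching_number_welldefined(1)[OF G] by auto
  moreover have "card F - card (g ` B) \<le> card M"
    unfolding M_def using diff_card_le_card_Diff[of "g ` B" F] fin by (auto simp: B_def)
  moreover have "card (g ` B) \<le> card B"
    using fin by (auto simp: B_def intro: card_image_le)
  ultimately show ?thesis unfolding B_def by linarith
qed

section \<open>Subdivision paths read along an orientation\<close>

text \<open>Choosing a first end \<open>a e\<close> and a last end \<open>b e\<close> gives each
  path a fixed direction, so that its vertices can be addressed by position. The orientation is
  arbitrary in the upper bound and adapted to the II-matching in the construction.\<close>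

locale oriented_graph =
  fixes G :: "'a graph" and k :: nat and a b :: "'a set \<Rightarrow> 'a"
  assumes G: "simple_graph G" and k: "k > 0"
    and ends: "\<And>e. e \<in> edges G \<Longrightarrow> {a e, b e} = e"
begin

definition P :: "'a set \<Rightarrow> nat \<Rightarrow> 'a subdiv_vertex" where
  "P e i = subdiv_path k (a e) (b e) i"

abbreviation S :: "'a subdiv_vertex graph" where
  "S \<equiv> subdivision k G"

lemma ends_neq: "e \<in> edges G \<Longrightarrow> a e \<noteq> b e"
  using G ends[of e] by (fastforce simp: simple_graph_def card_2_iff)

lemma ends_in: "e \<in> edges G \<Longrightarrow> a e \<in> verts G" "e \<in> edges G \<Longrightarrow> b e \<in> verts G"
  using G ends[of e] by (auto simp: simple_graph_def)

lemma P_0 [simp]: "P e 0 = Orig (a e)"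
  by (simp add: P_def subdiv_path_def)

lemma P_end [simp]: "P e (Suc k) = Orig (b e)"
  by (simp add: P_def subdiv_path_def)

lemma P_inner: "1 \<le> i \<Longrightarrow> i \<le> k \<Longrightarrow> P e i = Inner {(a e, i), (b e, k + 1 - i)}"
  by (simp add: P_def subdiv_path_def)

lemma P_not_Orig: "1 \<le> i \<Longrightarrow> i \<le> k \<Longrightarrow> P e i \<noteq> Orig u"
  by (simp add: P_inner)

text \<open>Only position \<open>i\<close> has to be interior: an inner vertex records the edge it
  subdivides, whereas an original vertex may be shared by several paths.\<close>

lemma P_inj:
  assumes "P e i = P e' j" "e \<in> edges G" "e' \<in> edges G" "1 \<le> i" "i \<le> k" "j \<le> k + 1"
  shows "e' = e" "j = i"
proof -
  show "e' = e"
    using subdiv_path_disjoint[of k "a e" "b e" i "a e'" "b e'" j] assms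
      ends[of e] ends[of e'] by (simp add: P_def)
  then show "j = i"
    using inj_onD[OF subdiv_path_inj[of "a e" "b e" k], of i j] assms ends_neq by (auto simp: P_def)
qed

lemma P_inj': "e \<in> edges G \<Longrightarrow> i \<le> k + 1 \<Longrightarrow> j \<le> k + 1 \<Longrightarrow> P e i = P e j \<longleftrightarrow> i = j"
  using inj_onD[OF subdiv_path_inj[of "a e" "b e" k], of i j] ends_neq by (auto simp: P_def)

lemma subdiv_path_eq_P:
  assumes "{u, v} \<in> edges G" "i \<le> k + 1"
  shows "subdiv_path k u v i = P {u, v} i \<or> subdiv_path k u v i = P {u, v} (k + 1 - i)"
proof -
  have "(u = a {u, v} \<and> v = b {u, v}) \<or> (u = b {u, v} \<and> v = a {u, v})"
    using ends[OF assms(1)] by (auto simp: doubleton_eq_iff)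
  then show ?thesis
    using subdiv_path_reverse[OF assms(2)] unfolding P_def by metis
qed

lemma edges_S: "edges S = {{P e i, P e (Suc i)} | e i. e \<in> edges G \<and> i \<le> k}"
proof (intro equalityI subsetI)
  fix x assume "x \<in> edges S"
  then obtain u v i where uv: "{u, v} \<in> edges G" "i \<le> k"
    "x = {subdiv_path k u v i, subdiv_path k u v (i + 1)}"
    by (auto simp: subdivision_def)
  have "(u = a {u, v} \<and> v = b {u, v}) \<or> (u = b {u, v} \<and> v = a {u, v})"
    using ends[OF uv(1)] by (auto simp: doubleton_eq_iff)
  then have "x = {P {u, v} i, P {u, v} (Suc i)} \<or> x = {P {u, v} (k - i), P {u, v} (Suc (k - i))}"
  proof
    assume "u = a {u, v} \<and> v = b {u, v}"
    then show ?thesis using uv by (simp add: P_def)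
  next
    \<comment> \<open>Here the path is traversed from its last end, so its edge number
      \<open>i\<close> is edge number \<open>k - i\<close> in the chosen direction.\<close>
    assume *: "u = b {u, v} \<and> v = a {u, v}"
    then have "subdiv_path k u v i = P {u, v} (k + 1 - i)"
      "subdiv_path k u v (i + 1) = P {u, v} (k + 1 - (i + 1))"
      using subdiv_path_reverse[of i k v u] subdiv_path_reverse[of "i + 1" k v u] uv(2)
      unfolding P_def by auto
    then show ?thesis using uv by (auto simp: Suc_diff_le insert_commute)
  qed
  then show "x \<in> {{P e i, P e (Suc i)} | e i. e \<in> edges G \<and> i \<le> k}"
    using uv(1,2) diff_le_self[of k i] by blast
next
  fix x assume "x \<in> {{P e i, P e (Suc i)} | e i. e \<in> edges G \<and> i \<le> k}"
  then obtain e i where "e \<in> edges G" "i \<le> k" "x = {P e i, P e (Suc i)}" by blast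
  then show "x \<in> edges S"
    unfolding subdivision_def P_def graph.simps Suc_eq_plus1 using ends[of e]
    by (intro CollectI exI[of _ "a e"] exI[of _ "b e"] exI[of _ i]) simp
qed

lemma verts_S: "verts S = Orig ` verts G \<union> (\<lambda>(e, i). P e i) ` (edges G \<times> {1..k})"
proof -
  have "{subdiv_path k u v i | u v i. {u, v} \<in> edges G \<and> 1 \<le> i \<and> i \<le> k} =
      (\<lambda>(e, i). P e i) ` (edges G \<times> {1..k})" (is "?L = ?R")
  proof (intro equalityI subsetI)
    fix x assume "x \<in> ?L"
    then obtain u v i where uv: "{u, v} \<in> edges G" "1 \<le> i" "i \<le> k" "x = subdiv_path k u v i" by blast
    then have "x = P {u, v} i \<or> x = P {u, v} (k + 1 - i)"
      using subdiv_path_eq_P by auto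
    moreover have "({u, v}, i) \<in> edges G \<times> {1..k}" "({u, v}, k + 1 - i) \<in> edges G \<times> {1..k}"
      using uv by auto
    ultimately show "x \<in> ?R" by (elim disjE) (rule rev_image_eqI, assumption, simp)+
  next
    fix x assume "x \<in> ?R"
    then obtain e i where "e \<in> edges G" "1 \<le> i" "i \<le> k" "x = subdiv_path k (a e) (b e) i"
      by (auto simp: P_def)
    moreover have "{a e, b e} \<in> edges G"
      using ends \<open>e \<in> edges G\<close> by simp
    ultimately show "x \<in> ?L" by blast
  qed
  then show ?thesis by (simp add: subdivision_def)
qed

lemma P_in_verts: "e \<in> edges G \<Longrightarrow> i \<le> Suc k \<Longrightarrow> P e i \<in> verts S"
proof -
  assume "e \<in> edges G" "i \<le> Suc k"
  then consider "i = 0" | "i = Suc k" | "1 \<le> i" "i \<le> k" by linarith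
  then show ?thesis
    using \<open>e \<in> edges G\<close> ends_in by cases (auto simp: verts_S)
qed

lemma inj_on_P: "inj_on (\<lambda>(e, i). P e i) (edges G \<times> {1..k})"
  using P_inj by (fastforce simp: inj_on_def)

lemma card_verts_S: "card (verts S) = num_verts G + k * num_edges G"
proof -
  have "card ((\<lambda>(e, i). P e i) ` (edges G \<times> {1..k})) = num_edges G * k"
    using card_image[OF inj_on_P] by (simp add: card_cartesian_product num_edges_def)
  moreover have "card (Orig ` verts G) = num_verts G"
    by (simp add: card_image inj_on_def num_verts_def)
  moreover have "Orig ` verts G \<inter> (\<lambda>(e, i). P e i) ` (edges G \<times> {1..k}) = {}"
    using P_not_Orig by (auto dest: sym)
  ultimately show ?thesis
    unfolding verts_S using G finite_edges[OF G]
    by (subst card_Un_disjoint) (auto simp: simple_graph_def)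
qed

lemma neighborhood_P:
  assumes "e \<in> edges G" "1 \<le> i" "i \<le> k" "w \<in> neighborhood S (P e i)"
  shows "w = P e (i - 1) \<or> w = P e (i + 1)"
proof -
  obtain e' j where e': "e' \<in> edges G" "j \<le> k" "{w, P e i} = {P e' j, P e' (Suc j)}"
    using assms(4) by (auto simp: neighborhood_def edges_S)
  then consider "P e i = P e' j" "w = P e' (Suc j)" | "P e i = P e' (Suc j)" "w = P e' j"
    by (auto simp: doubleton_eq_iff)
  then show ?thesis
  proof cases
    case 1
    then have "e' = e" "j = i" using P_inj[OF _ assms(1) e'(1) assms(2,3)] e'(2) by simp_all
    then show ?thesis using 1 by simp
  next
    case 2
    then have "e' = e" "Suc j = i" using P_inj[OF _ assms(1) e'(1) assms(2,3)] e'(2) by simp_all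
    then show ?thesis using 2 by auto
  qed
qed

lemma neighborhood_Orig:
  assumes "w \<in> neighborhood S (Orig u)"
  shows "\<exists>e \<in> edges G. a e = u \<and> w = P e 1 \<or> b e = u \<and> w = P e k"
proof -
  obtain e j where e: "e \<in> edges G" "j \<le> k" "{w, Orig u} = {P e j, P e (Suc j)}"
    using assms by (auto simp: neighborhood_def edges_S)
  then consider "Orig u = P e j" "w = P e (Suc j)" | "Orig u = P e (Suc j)" "w = P e j"
    by (auto simp: doubleton_eq_iff)
  then show ?thesis
  proof cases
    case 1
    then have "j = 0" using P_not_Orig[of j e u] e by (cases "j = 0") auto
    then show ?thesis using 1 e by auto
  next
    case 2
    then have "j = k" using P_not_Orig[of "Suc j" e u] e by (cases "j = k") auto
    then show ?thesis using 2 e by auto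
  qed
qed

lemma P_adjacent:
  assumes "e \<in> edges G" "i \<le> k"
  shows "P e i \<in> neighborhood S (P e (Suc i))" "P e (Suc i) \<in> neighborhood S (P e i)"
proof -
  have "{P e i, P e (Suc i)} \<in> edges S"
    using assms unfolding edges_S by blast
  then show "P e i \<in> neighborhood S (P e (Suc i))" "P e (Suc i) \<in> neighborhood S (P e i)"
    using P_in_verts[of e i] P_in_verts[of e "Suc i"] assms
    by (simp_all add: neighborhood_def insert_commute)
qed

section \<open>Upper bound for the complement of a super dominating set\<close>

lemma super_dominating_compl_le:
  assumes D: "super_dominating_set S D" and k4: "k mod 4 = 2"
  shows "card (verts S - D) \<le> k div 2 * num_edges G + II_matching_number G"
proof -
  define X where "X = verts S - D"
  have finX: "finite X"
    using simple_graph_subdivision[OF G, of k] by (simp add: X_def simple_graph_def)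
  have "\<forall>x\<in>X. \<exists>y. y \<in> D \<and> neighborhood S y \<inter> X = {x}"
    using D unfolding super_dominating_set_def X_def by blast
  then obtain f where "\<forall>x\<in>X. f x \<in> D \<and> neighborhood S (f x) \<inter> X = {x}"
    by (rule bchoice[THEN exE])
  then have fD: "f x \<notin> X" and fN: "neighborhood S (f x) \<inter> X = {x}" if "x \<in> X" for x
    using that by (auto simp: X_def)
  define Mt where "Mt = (\<lambda>x. {x, f x}) ` X"
  have Mt_edges: "Mt \<subseteq> edges S"
    using fN by (force simp: Mt_def neighborhood_def)
  \<comment> \<open>The private neighbour \<open>f x\<close> lies outside \<open>X\<close> and
    determines \<open>x\<close>, its only neighbour in \<open>X\<close>. So two pairs sharing a
    vertex coincide.\<close>
  have disj: "m = m'" if m: "m \<in> Mt" "m' \<in> Mt" and p: "p \<in> m" "p \<in> m'" for m m' p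
  proof -
    obtain x x' where x: "x \<in> X" "x' \<in> X" "m = {x, f x}" "m' = {x', f x'}"
      using m unfolding Mt_def by blast
    then consider "x = x'" | "f x = f x'"
      using p fD by blast
    then have "x = x'"
    proof cases
      assume "f x = f x'"
      then show ?thesis using fN[OF x(1)] fN[OF x(2)] by (metis singleton_inject)
    qed
    then show ?thesis
      using x by simp
  qed
  have "inj_on (\<lambda>x. {x, f x}) X"
    using fD by (auto simp: inj_on_def doubleton_eq_iff)
  then have card_X: "card X = card Mt"
    by (simp add: Mt_def card_image)
  \<comment> \<open>If \<open>q\<close> were the private neighbour of some \<open>x\<close>, its
    neighbour \<open>p\<close> in \<open>X\<close> would have to be \<open>x\<close>, making
    \<open>{p, q}\<close> a matching edge.\<close>
  have spread: "q \<in> X" if "p \<in> X" "q \<in> \<Union>Mt" "p \<in> neighborhood S q" "{p, q} \<notin> Mt" for p q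
  proof (rule ccontr)
    assume "q \<notin> X"
    with that(2) obtain x where x: "x \<in> X" "q = f x"
      by (auto simp: Mt_def)
    then have "p = x" using fN[of x] that by blast
    then show False using that x by (auto simp: Mt_def)
  qed
  have same: "P e i \<in> X \<longleftrightarrow> P e (Suc i) \<in> X"
    if "e \<in> edges G" "i \<le> k" "P e i \<in> \<Union>Mt" "P e (Suc i) \<in> \<Union>Mt" "{P e i, P e (Suc i)} \<notin> Mt" for e i
    using spread[of "P e i" "P e (Suc i)"] spread[of "P e (Suc i)" "P e i"]
      P_adjacent[of e i] that by (auto simp: insert_commute)
  have diff: "q \<in> X \<longleftrightarrow> p \<notin> X" if "{p, q} \<in> Mt" for p q
    using that fD by (auto simp: Mt_def doubleton_eq_iff)
  define I where "I e = {i. i \<le> k \<and> {P e i, P e (Suc i)} \<in> Mt}" for e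
  have sparse: "Suc i \<notin> I e" if "e \<in> edges G" "i \<in> I e" for e i
  proof
    assume "Suc i \<in> I e"
    then have "{P e i, P e (Suc i)} = {P e (Suc i), P e (Suc (Suc i))}"
      using that by (intro disj[of _ _ "P e (Suc i)"]) (auto simp: I_def)
    then have "P e i = P e (Suc (Suc i))"
      by (auto simp: doubleton_eq_iff)
    then show False
      using P_inj'[OF that(1), of i "Suc (Suc i)"] \<open>Suc i \<in> I e\<close> by (simp add: I_def)
  qed
  \<comment> \<open>Along alternating matching and non-matching edges, \<open>diff\<close> flips
    membership in \<open>X\<close> and \<open>same\<close> keeps it. The position after matching
    edge number \<open>j\<close>, counted from 0, has undergone \<open>j + 1\<close> flips.\<close>
  have alt: "P e (Suc (c + 2 * j)) \<in> X \<longleftrightarrow> (P e c \<in> X \<longleftrightarrow> odd j)"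
    if e: "e \<in> edges G" and I: "\<forall>i\<le>r. c + 2 * i \<in> I e" and "j \<le> r" for e c r j
    using \<open>j \<le> r\<close>
  proof (induction j)
    case 0
    have "c \<in> I e" using I by (metis add_0_right mult_0_right zero_le)
    then show ?case using diff[of "P e c" "P e (Suc c)"] by (simp add: I_def)
  next
    case (Suc j)
    define i where "i = c + 2 * j"
    have i: "i \<in> I e" "Suc (Suc i) \<in> I e"
      using spec[OF I, of j] spec[OF I, of "Suc j"] Suc.prems by (auto simp: i_def)
    then have "Suc i \<notin> I e" "Suc i \<le> k"
      using sparse[OF e] by (auto simp: I_def)
    then have "P e (Suc i) \<in> X \<longleftrightarrow> P e (Suc (Suc i)) \<in> X"
      using i by (intro same[OF e]) (auto simp: I_def)
    moreover have "P e (Suc (Suc (Suc i))) \<in> X \<longleftrightarrow> P e (Suc (Suc i)) \<notin> X"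
      using i by (intro diff) (auto simp: I_def)
    ultimately show ?case
      using Suc by (auto simp: i_def)
  qed
  \<comment> \<open>A path has \<open>2 * r + 1\<close> edges, at positions \<open>0\<close> to
    \<open>2 * r\<close>, so it holds at most \<open>r + 1\<close> matching edges. The residue of
    \<open>k\<close> enters through the oddness of \<open>r\<close>.\<close>
  define r where "r = k div 2"
  have kr: "2 * r = k" and r: "odd r" "r > 0"
    using k4 k by (presburger add: r_def)+
  have I_full: "card (I e) \<le> Suc r" "card (I e) = Suc r \<Longrightarrow> \<forall>j\<le>r. 0 + 2 * j \<in> I e"
    if "e \<in> edges G" for e
  proof -
    have "I e \<subseteq> {0..0 + 2 * r}" by (auto simp: I_def kr)
    from sparse_card[OF this sparse[OF that]]
    show "card (I e) \<le> Suc r" "card (I e) = Suc r \<Longrightarrow> \<forall>j\<le>r. 0 + 2 * j \<in> I e"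
      by blast+
  qed
  define F where "F = {e \<in> edges G. card (I e) = Suc r}"
  \<comment> \<open>A full path uses its first and its last edge, so both original ends are matched
    into this very path. As the matching covers an original vertex only once, full edges of
    \<open>G\<close> cannot share a vertex.\<close>
  have cov: "\<exists>i. 1 \<le> i \<and> i \<le> k \<and> {Orig u, P e i} \<in> Mt" if "e \<in> F" "u \<in> e" for e u
  proof -
    have e: "e \<in> edges G" and *: "\<forall>j\<le>r. 2 * j \<in> I e"
      using that(1) I_full[of e] by (auto simp: F_def)
    have "0 \<in> I e" "k \<in> I e"
      using spec[OF *, of 0] spec[OF *, of r] by (auto simp: kr)
    then have "{Orig (a e), P e 1} \<in> Mt" "{Orig (b e), P e k} \<in> Mt"
      by (auto simp: I_def insert_commute)
    moreover have "u = a e \<or> u = b e"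
      using ends[OF e] that(2) by auto
    ultimately show ?thesis using k by (metis One_nat_def Suc_leI order_refl)
  qed
  have cov_unique: "e = e'" if "{Orig u, P e i} \<in> Mt" "{Orig u, P e' j} \<in> Mt"
    "e \<in> edges G" "e' \<in> edges G" "1 \<le> i" "i \<le> k" "1 \<le> j" "j \<le> k" for e e' u i j
  proof -
    have "{Orig u, P e i} = {Orig u, P e' j}"
      using that by (intro disj[of _ _ "Orig u"]) auto
    then have "P e i = P e' j"
      by (auto simp: doubleton_eq_iff)
    then show ?thesis
      using P_inj(1)[OF _ that(3-6), of j] that(8) by simp
  qed
  have F_disj: "e = e'" if "e \<in> F" "e' \<in> F" "u \<in> e" "u \<in> e'" for e e' u
  proof -
    obtain i j where "1 \<le> i" "i \<le> k" "{Orig u, P e i} \<in> Mt"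
      "1 \<le> j" "j \<le> k" "{Orig u, P e' j} \<in> Mt"
      using cov[OF \<open>e \<in> F\<close> \<open>u \<in> e\<close>] cov[OF \<open>e' \<in> F\<close> \<open>u \<in> e'\<close>] by blast
    moreover have "e \<in> edges G" "e' \<in> edges G"
      using that by (simp_all add: F_def)
    ultimately show ?thesis using cov_unique by blast
  qed
  then have F: "is_matching G F"
    unfolding is_matching_def by (auto simp: F_def)
  have colour_ends: "(\<forall>u\<in>e. \<forall>v\<in>e. (Orig u \<in> X) = (Orig v \<in> X)) \<longleftrightarrow>
      (P e 0 \<in> X \<longleftrightarrow> P e (Suc k) \<in> X)" if "e \<in> edges G" for e
  proof -
    have "(\<forall>u\<in>{a e, b e}. \<forall>v\<in>{a e, b e}. (Orig u \<in> X) = (Orig v \<in> X)) \<longleftrightarrow>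
      (P e 0 \<in> X \<longleftrightarrow> P e (Suc k) \<in> X)" by auto
    then show ?thesis unfolding ends[OF that] .
  qed
  \<comment> \<open>A full path has \<open>r + 1\<close> matching edges, an even number of flips, so
    its two ends agree.\<close>
  have mono: "(Orig u \<in> X) = (Orig v \<in> X)" if "e \<in> F" "u \<in> e" "v \<in> e" for e u v
  proof -
    have e: "e \<in> edges G" using that by (simp add: F_def)
    then have "P e (Suc (0 + 2 * r)) \<in> X \<longleftrightarrow> (P e 0 \<in> X \<longleftrightarrow> odd r)"
      using that(1) I_full[of e] by (intro alt[of e r]) (auto simp: F_def)
    then have "P e 0 \<in> X \<longleftrightarrow> P e (Suc k) \<in> X"
      using r by (simp add: kr)
    then show ?thesis
      using colour_ends[OF e] that by blast
  qed
  define B where "B = {e \<in> edges G - F. e \<subseteq> \<Union>F \<and> (\<forall>u\<in>e. \<forall>v\<in>e. (Orig u \<in> X) = (Orig v \<in> X))}"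
  have B_deficient: "Suc (card (I e)) \<le> r" if "e \<in> B" for e
  proof -
    have e: "e \<in> edges G" "e \<notin> F" "e \<subseteq> \<Union>F"
      using that by (simp_all add: B_def)
    have col: "P e 0 \<in> X \<longleftrightarrow> P e (Suc k) \<in> X"
      using that unfolding colour_ends[OF e(1), symmetric] B_def by blast
    have outside: "Orig u \<in> \<Union>Mt \<and> {Orig u, P e i} \<notin> Mt" if "u \<in> e" "1 \<le> i" "i \<le> k" for u i
    proof -
      from e that obtain f where f: "f \<in> F" "u \<in> f" by blast
      then obtain j where "1 \<le> j" "j \<le> k" "{Orig u, P f j} \<in> Mt" using cov by blast
      moreover have "f \<in> edges G" "f \<noteq> e"
        using f e by (auto simp: F_def)
      ultimately show ?thesis
        using cov_unique[of u e i f j] that e(1) by blast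
    qed
    have ab: "a e \<in> e" "b e \<in> e"
      using ends[OF e(1)] by auto
    have 0: "Orig (a e) \<in> \<Union>Mt" "0 \<notin> I e" and k': "Orig (b e) \<in> \<Union>Mt" "k \<notin> I e"
      using outside[OF ab(1), of 1] outside[OF ab(2), of k] k by (auto simp: I_def insert_commute)
    have k_eq: "Suc (1 + 2 * (r - 1)) = k"
      using r(2) kr by simp
    have "i \<in> {1..1 + 2 * (r - 1)}" if "i \<in> I e" for i
    proof -
      have "i \<noteq> 0" "i \<noteq> k"
        using 0(2) k'(2) that by metis+
      moreover have "i \<le> k"
        using that by (simp add: I_def)
      ultimately show ?thesis using k_eq by simp
    qed
    then have *: "card (I e) \<le> Suc (r - 1)" "card (I e) = Suc (r - 1) \<Longrightarrow> \<forall>j\<le>r - 1. 1 + 2 * j \<in> I e"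
      using sparse_card[OF subsetI sparse[OF e(1)]] by blast+
    \<comment> \<open>With exactly \<open>r\<close> matching edges all odd positions are used, and
      \<open>r\<close> flips separate \<open>P e 1\<close> from \<open>P e k\<close>. The two
      outermost edges of the path are unmatched edges between covered vertices, hence keep
      membership; so the ends of \<open>e\<close> would differ, against \<open>col\<close>.\<close>
    have "card (I e) \<noteq> Suc (r - 1)"
    proof
      assume "card (I e) = Suc (r - 1)"
      then have I: "\<forall>j\<le>r - 1. 1 + 2 * j \<in> I e" using * by blast
      have "P e (Suc (1 + 2 * (r - 1))) \<in> X \<longleftrightarrow> (P e 1 \<in> X \<longleftrightarrow> odd (r - 1))"
        using alt[OF e(1) I] by blast
      moreover have "even (r - 1)"
        using r by simp
      ultimately have "P e k \<in> X \<longleftrightarrow> P e 1 \<notin> X"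
        unfolding k_eq by blast
      moreover have "k - 1 = 1 + 2 * (r - 1)"
        using k_eq by simp
      then have "1 \<in> I e" "k - 1 \<in> I e"
        using spec[OF I, of 0] spec[OF I, of "r - 1"] by auto
      then have "P e 1 \<in> \<Union>Mt" "P e k \<in> \<Union>Mt"
        using k by (auto simp: I_def)
      then have "P e 0 \<in> X \<longleftrightarrow> P e (Suc 0) \<in> X" "P e k \<in> X \<longleftrightarrow> P e (Suc k) \<in> X"
        using 0 k' by (intro same[OF e(1)]; auto simp: I_def)+
      ultimately show False using col by simp
    qed
    then show ?thesis using * r by linarith
  qed
  have fin: "finite (edges G)" using G by (rule finite_edges)
  have "Mt \<subseteq> (\<Union>e\<in>edges G. (\<lambda>i. {P e i, P e (Suc i)}) ` I e)"
  proof
    fix m assume "m \<in> Mt"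
    then obtain e i where "e \<in> edges G" "i \<le> k" "m = {P e i, P e (Suc i)}"
      using Mt_edges unfolding edges_S by blast
    then show "m \<in> (\<Union>e\<in>edges G. (\<lambda>i. {P e i, P e (Suc i)}) ` I e)"
      using \<open>m \<in> Mt\<close> by (auto simp: I_def)
  qed
  moreover have fin_I: "finite (I e)" for e
    by (rule finite_subset[of _ "{..k}"]) (auto simp: I_def)
  ultimately have "card Mt \<le> card (\<Union>e\<in>edges G. (\<lambda>i. {P e i, P e (Suc i)}) ` I e)"
    using fin by (intro card_mono) auto
  also have "\<dots> \<le> (\<Sum>e\<in>edges G. card ((\<lambda>i. {P e i, P e (Suc i)}) ` I e))"
    using fin by (rule card_UN_le)
  also have "\<dots> \<le> (\<Sum>e\<in>edges G. card (I e))"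
    by (intro sum_mono card_image_le fin_I)
  finally have "card X \<le> (\<Sum>e\<in>edges G. card (I e))"
    by (simp add: card_X)
  \<comment> \<open>The account for a single edge: the baseline is \<open>r\<close>, full edges gain
    one, and deficient edges lose at least one.\<close>
  moreover have "(\<Sum>e\<in>edges G. card (I e) + (if e \<in> B then 1 else 0)) \<le>
      (\<Sum>e\<in>edges G. r + (if e \<in> F then 1 else 0))"
  proof (rule sum_mono)
    fix e assume e: "e \<in> edges G"
    show "card (I e) + (if e \<in> B then 1 else 0) \<le> r + (if e \<in> F then 1 else 0)"
      using I_full(1)[OF e] B_deficient[of e] e by (auto simp: F_def le_Suc_eq)
  qed
  moreover have "(\<Sum>e\<in>edges G. if e \<in> B then 1 else 0) = card B"
    "(\<Sum>e\<in>edges G. if e \<in> F then 1 else 0) = card F"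
    using fin by (auto simp: sum.If_cases B_def F_def Int_def intro!: arg_cong[of _ _ card])
  ultimately have "card X + card B \<le> r * num_edges G + card F"
    by (simp add: sum.distrib num_edges_def mult.commute)
  moreover have "card F \<le> II_matching_number G + card B"
    unfolding B_def by (rule matching_le_II_matching_number[OF G F mono])
  ultimately show ?thesis
    by (simp add: X_def r_def)
qed

section \<open>Construction of a super dominating set from an II-matching\<close>

lemma ex_super_dominating:
  assumes k4: "k mod 4 = 2" and M: "is_matching G (M1 \<union> M2)" and disj: "M1 \<inter> M2 = {}"
    and orient: "\<And>e. e \<in> edges G \<Longrightarrow> e \<notin> M1 \<union> M2 \<Longrightarrow> a e \<notin> \<Union>M2 \<and> b e \<notin> \<Union>M1"
  shows "\<exists>D. super_dominating_set S D \<and>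
    card (verts S - D) = k div 2 * num_edges G + card (M1 \<union> M2)"
proof -
  have ME: "M1 \<subseteq> edges G" "M2 \<subseteq> edges G"
    and M_disj: "\<And>e f u. e \<in> M1 \<union> M2 \<Longrightarrow> f \<in> M1 \<union> M2 \<Longrightarrow> u \<in> e \<Longrightarrow> u \<in> f \<Longrightarrow> e = f"
    using M unfolding is_matching_def by blast+
  have ab: "a e \<in> e" "b e \<in> e" if "e \<in> edges G" for e
    using ends[OF that] by auto
  \<comment> \<open>The edges of \<open>M1\<close> become the full edges with ends in \<open>X\<close>, those of \<open>M2\<close> the full edges with
    ends outside; the shift 3 makes the pattern on any other path start in \<open>X\<close> and end outside,
    which agrees with the ends by \<open>orient\<close>.\<close>
  define s where "s e = (if e \<in> M1 then 0 else if e \<in> M2 then 2 else 3 :: nat)" for e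
  define pat where "pat e i \<longleftrightarrow> (i + s e) mod 4 \<in> {0, 3}" for e i
  define J where "J = Sigma (edges G) (\<lambda>e. {i \<in> {1..k}. pat e i})"
  define X where "X = Orig ` \<Union>M1 \<union> (\<lambda>(e, i). P e i) ` J"
  have X_inner: "P e i \<in> X \<longleftrightarrow> pat e i" if e: "e \<in> edges G" and i: "1 \<le> i" "i \<le> k" for e i
  proof
    assume "P e i \<in> X"
    moreover have "P e i \<notin> Orig ` \<Union>M1"
      using P_not_Orig[OF i] by blast
    ultimately obtain e' j where j: "e' \<in> edges G" "j \<le> k" "pat e' j" "P e i = P e' j"
      unfolding X_def J_def by auto
    then show "pat e i"
      using P_inj[OF j(4) e j(1) i] by simp
  next
    assume "pat e i"
    then have "(e, i) \<in> J" using e i by (simp add: J_def)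
    then show "P e i \<in> X" unfolding X_def by (intro UnI2 rev_image_eqI) auto
  qed
  have X_Orig: "Orig u \<in> X \<longleftrightarrow> u \<in> \<Union>M1" for u
  proof -
    have "Orig u \<notin> (\<lambda>(e, i). P e i) ` J"
      using P_not_Orig by (auto simp: J_def dest: sym)
    then show ?thesis by (auto simp: X_def)
  qed
  \<comment> \<open>At original vertices only this implication is available: on a path with shift 3
    the pattern also marks position 0, although \<open>a e\<close> may be outside \<open>X\<close>.
    The implication suffices, since privacy only requires vertices to be outside
    \<open>X\<close>.\<close>
  have X_pat: "pat e i" if e: "e \<in> edges G" and "i \<le> Suc k" "P e i \<in> X" for e i
  proof -
    consider "i = 0" | "i = Suc k" | "1 \<le> i" "i \<le> k"
      using \<open>i \<le> Suc k\<close> by linarith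
    then show ?thesis
    proof cases
      case 1
      then have "a e \<in> \<Union>M1" using that X_Orig by simp
      then have "e \<notin> M2" using M_disj[of e _ "a e"] ab(1)[OF e] disj by blast
      then show ?thesis using 1 by (simp add: pat_def s_def)
    next
      case 2
      then have "b e \<in> \<Union>M1" using that X_Orig by simp
      then have "e \<notin> M2" "e \<in> M1 \<union> M2"
        using M_disj[of e _ "b e"] ab(2)[OF e] disj orient[OF e] by blast+
      moreover have "Suc k mod 4 = 3" using k4 by presburger
      ultimately show ?thesis using 2 by (simp add: pat_def s_def)
    next
      case 3
      then show ?thesis using X_inner[OF e] that by simp
    qed
  qed
  have rep: "\<exists>e i. e \<in> edges G \<and> i \<le> Suc k \<and> x = P e i \<and> pat e i \<and> (1 \<le> i \<and> i \<le> k \<or> e \<in> M1)"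
    if "x \<in> X" for x
  proof -
    have "Suc k mod 4 = 3" using k4 by presburger
    then have pat_ends: "pat e 0" "pat e (Suc k)" if "e \<in> M1" for e
      using that by (simp_all add: pat_def s_def)
    consider u e where "x = Orig u" "u \<in> e" "e \<in> M1" | e i where "x = P e i" "(e, i) \<in> J"
      using \<open>x \<in> X\<close> unfolding X_def by auto
    then show ?thesis
    proof cases
      case (1 u e)
      then have e: "e \<in> edges G" using ME by blast
      then have "x = P e 0 \<or> x = P e (Suc k)"
        using 1 ends[OF e] by auto
      then show ?thesis
        using e 1(3) pat_ends by blast
    next
      case (2 e i)
      then show ?thesis by (auto simp: J_def intro!: exI[of _ e] exI[of _ i])
    qed
  qed
  \<comment> \<open>A vertex of residue 0 takes its successor, of residue 1, and one of residue 3
    takes its predecessor, of residue 2. The partner's other neighbour on the path then has residue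
    2 or 1 and is unmarked. The last conjunct says that a partner is an original vertex only on a
    path of \<open>M2\<close>.\<close>
  have partner: "\<exists>j. j \<le> Suc k \<and> \<not> pat e j \<and> (i = Suc j \<and> (1 \<le> j \<longrightarrow> \<not> pat e (j - 1)) \<or>
      j = Suc i \<and> \<not> pat e (Suc j)) \<and> (1 \<le> j \<and> j \<le> k \<or> e \<in> M2)"
    if prem: "i \<le> Suc k" "pat e i" "1 \<le> i \<and> i \<le> k \<or> e \<in> M1" for e i
  proof -
    have s: "s e = 0 \<and> e \<in> M1 \<or> s e = 2 \<and> e \<in> M2 \<or> s e = 3 \<and> e \<notin> M1"
      by (auto simp: s_def)
    consider "(i + s e) mod 4 = 0" | "(i + s e) mod 4 = 3"
      using prem(2) by (auto simp: pat_def)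
    then show ?thesis
    proof cases
      case 1
      then have m: "(Suc i + s e) mod 4 = 1" "(Suc (Suc i) + s e) mod 4 = 2"
        by presburger+
      have "i \<noteq> Suc k"
      proof
        assume "i = Suc k"
        then have "s e = 0" using prem(3) by (simp add: s_def)
        then show False using 1 k4 \<open>i = Suc k\<close> by presburger
      qed
      moreover have "e \<in> M2" if "i = k"
      proof (rule ccontr)
        assume "e \<notin> M2"
        then have "s e = 0 \<or> s e = 3" using s by blast
        then show False using 1 k4 \<open>i = k\<close> by presburger
      qed
      ultimately have "Suc i \<le> Suc k" "Suc i \<le> k \<or> e \<in> M2"
        using prem(1) by (cases "i = k"; simp)+
      then show ?thesis
        using m by (intro exI[of _ "Suc i"]) (auto simp: pat_def)
    next
      case 2
      have "i \<noteq> 0"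
      proof
        assume "i = 0"
        then have "s e = 0" using prem(3) by (simp add: s_def)
        then show False using 2 \<open>i = 0\<close> by simp
      qed
      then obtain j where j: "i = Suc j" by (cases i) auto
      have "(n + s e) mod 4 = 2" if "(Suc n + s e) mod 4 = 3" for n
        using that by presburger
      then have m: "(j + s e) mod 4 = 2"
        using 2 j by blast
      have "(n + s e) mod 4 = 1" if "(Suc n + s e) mod 4 = 2" for n
        using that by presburger
      then have m': "(j - 1 + s e) mod 4 = 1" if "1 \<le> j"
        using m that by (cases j) auto
      have "e \<in> M2" if "j = 0"
      proof (rule ccontr)
        assume "e \<notin> M2"
        then have "s e = 0 \<or> s e = 3" using s by blast
        then show False using 2 \<open>j = 0\<close> j by auto
      qed
      then have "1 \<le> j \<or> e \<in> M2"
        by (cases j) auto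
      then show ?thesis
        using m m' prem(1,3) j
        by (intro exI[of _ j]) (auto simp: pat_def)
    qed
  qed
  have priv: "\<exists>y \<in> verts S - X. neighborhood S y \<inter> X = {x}" if x: "x \<in> X" for x
  proof -
    obtain e i where e: "e \<in> edges G" and i: "i \<le> Suc k" "x = P e i" "pat e i"
      "1 \<le> i \<and> i \<le> k \<or> e \<in> M1"
      using rep[OF x] by blast
    obtain j where j: "j \<le> Suc k" "\<not> pat e j" "1 \<le> j \<and> j \<le> k \<or> e \<in> M2"
      and ij: "i = Suc j \<and> (1 \<le> j \<longrightarrow> \<not> pat e (j - 1)) \<or> j = Suc i \<and> \<not> pat e (Suc j)"
      using partner[OF i(1,3,4)] by blast
    have "P e j \<notin> X" using X_pat[OF e j(1)] j(2) by blast
    moreover have "x \<in> neighborhood S (P e j)"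
      using ij P_adjacent[OF e, of i] P_adjacent[OF e, of j] i(1,2) j(1) by auto
    moreover have "w = x" if w: "w \<in> neighborhood S (P e j)" "w \<in> X" for w
    proof (cases "1 \<le> j \<and> j \<le> k")
      case True
      then have "w = P e (j - 1) \<or> w = P e (j + 1)"
        using neighborhood_P[OF e _ _ w(1)] by blast
      moreover have "j - 1 \<le> Suc k" "j + 1 \<le> Suc k"
        using True by auto
      ultimately show ?thesis
        using True ij X_pat[OF e, of "j - 1"] X_pat[OF e, of "j + 1"] w(2) i(2) by auto
    next
      case False
      then have e2: "e \<in> M2"
        using j(3) by blast
      have "j = 0 \<or> j = Suc k"
        using False j(1) by linarith
      then obtain u where u: "P e j = Orig u" "u \<in> e"
        using ab[OF e] by auto
      obtain e' where e': "e' \<in> edges G" "a e' = u \<and> w = P e' 1 \<or> b e' = u \<and> w = P e' k"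
        using neighborhood_Orig[of w u] w(1) u(1) by auto
      show ?thesis
      proof (cases "e' = e")
        case True
        from \<open>j = 0 \<or> j = Suc k\<close> show ?thesis
        proof
          assume "j = 0"
          then show ?thesis
            using True u(1) e'(2) ends_neq[OF e] ij i(2) by auto
        next
          assume "j = Suc k"
          then show ?thesis
            using True u(1) e'(2) ends_neq[OF e] ij i(1,2) by auto
        qed
      next
        case False
        \<comment> \<open>The remaining neighbours of \<open>u\<close> lie on paths of edges outside
          the matching. Since \<open>u\<close> is covered by \<open>M2\<close>,
          \<open>orient\<close> forces \<open>u\<close> to be the last end of \<open>e'\<close>, and
          the inner vertex next to it has residue \<open>k + 3\<close>, that is 1 modulo 4.\<close>
        have "u \<in> e'" using e'(2) ab[OF e'(1)] by auto
        then have "e' \<notin> M1 \<union> M2"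
          using M_disj[of e' e u] e2 u(2) False by blast
        moreover have "a e' \<noteq> u"
          using orient[OF e'(1) \<open>e' \<notin> M1 \<union> M2\<close>] e2 u(2) by blast
        ultimately have "w = P e' k" "s e' = 3"
          using e'(2) by (auto simp: s_def)
        moreover have "(k + 3) mod 4 = 1" using k4 by presburger
        ultimately have "\<not> pat e' k" by (simp add: pat_def)
        then show ?thesis
          using X_pat[OF e'(1), of k] w(2) \<open>w = P e' k\<close> by simp
      qed
    qed
    ultimately have "P e j \<in> verts S - X" "neighborhood S (P e j) \<inter> X = {x}"
      using P_in_verts[OF e j(1)] x by blast+
    then show ?thesis by (rule bexI[rotated])
  qed
  have "\<Union>M1 \<subseteq> verts G"
    using ME(1) G by (auto simp: simple_graph_def)
  then have XV: "X \<subseteq> verts S"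
    unfolding X_def J_def verts_S by (intro Un_mono image_mono) auto
  have fin: "finite (edges G)" using G by (rule finite_edges)
  have finM: "finite M1" "finite M2"
    using ME fin by (auto intro: finite_subset)
  define t where "t = k div 4"
  have kt: "k = 4 * t + 2" using k4 by (simp add: t_def) presburger
  have card2: "card e = 2" if "e \<in> edges G" for e
    using G that by (simp add: simple_graph_def)
  have card_M1: "card (\<Union>M1) = (\<Sum>e\<in>M1. card e)"
  proof (rule card_Union_disjoint)
    show "pairwise disjnt M1"
      using M unfolding pairwise_def disjnt_def is_matching_def by blast
    show "finite e" if "e \<in> M1" for e
      using card2[OF subsetD[OF ME(1) that]] by (intro card_ge_0_finite) simp
  qed
  have "inj_on (\<lambda>(e, i). P e i) J"
    by (rule inj_on_subset[OF inj_on_P]) (auto simp: J_def)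
  then have "card ((\<lambda>(e, i). P e i) ` J) = card J"
    by (rule card_image)
  also have "card J = (\<Sum>e\<in>edges G. card {i \<in> {1..k}. pat e i})"
    unfolding J_def using fin by (intro card_SigmaI) auto
  finally have card_J: "card ((\<lambda>(e, i). P e i) ` J) = \<dots>" .
  have "Orig ` \<Union>M1 \<inter> (\<lambda>(e, i). P e i) ` J = {}"
    using P_not_Orig by (auto simp: J_def dest: sym)
  moreover have "finite (verts S)"
    using simple_graph_subdivision[OF G, of k] by (simp add: simple_graph_def)
  then have "finite X" using XV by (rule rev_finite_subset)
  ultimately have "card X = card (Orig ` \<Union>M1) + card ((\<lambda>(e, i). P e i) ` J)"
    unfolding X_def by (intro card_Un_disjoint) auto
  also have "card (Orig ` \<Union>M1) = (\<Sum>e\<in>M1. 2)"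
    using card2[OF subsetD[OF ME(1)]] by (simp add: card_image inj_on_def card_M1)
  also have "\<dots> = (\<Sum>e\<in>edges G. if e \<in> M1 then 2 else 0)"
    using fin ME by (simp add: sum.If_cases Int_absorb1)
  finally have "card X = (\<Sum>e\<in>edges G. (if e \<in> M1 then 2 else 0) + card {i \<in> {1..k}. pat e i})"
    by (simp add: card_J sum.distrib)
  \<comment> \<open>The two original ends of an \<open>M1\<close> edge are charged to that edge.
    With \<open>k div 2 = 2 * t + 1\<close>, edges of \<open>M1\<close> contribute
    \<open>2 + 2 * t\<close>, edges of \<open>M2\<close> contribute \<open>2 * t + 2\<close>, and
    all others \<open>2 * t + 1\<close>.\<close>
  also have "\<dots> = (\<Sum>e\<in>edges G. k div 2 + (if e \<in> M1 \<union> M2 then 1 else 0))"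
  proof (rule sum.cong)
    fix e
    have "card {i \<in> {1..k}. pat e i} = (if e \<in> M1 then 2 * t else if e \<in> M2 then 2 * t + 2 else 2 * t + 1)"
      using card_pattern[of t] by (simp add: pat_def s_def kt)
    then show "(if e \<in> M1 then 2 else 0) + card {i \<in> {1..k}. pat e i} =
        k div 2 + (if e \<in> M1 \<union> M2 then 1 else 0)"
      using disj by (auto simp: kt)
  qed simp
  also have "\<dots> = k div 2 * num_edges G + card (M1 \<union> M2)"
  proof -
    have "(\<Sum>e\<in>edges G. if e \<in> M1 \<union> M2 then 1 else 0) = card (edges G \<inter> (M1 \<union> M2))"
      using fin by (simp add: sum.If_cases del: Un_iff)
    also have "edges G \<inter> (M1 \<union> M2) = M1 \<union> M2"
      using ME by blast
    finally show ?thesis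
      by (simp add: sum.distrib num_edges_def mult.commute del: Un_iff)
  qed
  finally have "card X = k div 2 * num_edges G + card (M1 \<union> M2)" .
  moreover have "verts S - (verts S - X) = X"
    using XV by blast
  ultimately show ?thesis
    using super_dominating_set_complI[OF XV priv] by metis
qed

end

section \<open>Choice of the orientation and the final formula\<close>

text \<open>Inducedness forbids an edge outside the matching with both ends covered by
  \<open>M1\<close>, or both by \<open>M2\<close>, and no vertex is covered by both. So every such
  edge can be directed away from \<open>M1\<close> and towards \<open>M2\<close>.\<close>

lemma ex_orientation:
  assumes G: "simple_graph G" and M: "is_matching G (M1 \<union> M2)" "M1 \<inter> M2 = {}"
    and ind: "induced_matching G M1" "induced_matching G M2"
  shows "\<exists>a b. \<forall>e \<in> edges G. {a e, b e} = e \<and>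
    (e \<notin> M1 \<union> M2 \<longrightarrow> a e \<notin> \<Union>M2 \<and> b e \<notin> \<Union>M1)"
proof -
  have "\<exists>p. {fst p, snd p} = e \<and> (e \<notin> M1 \<union> M2 \<longrightarrow> fst p \<notin> \<Union>M2 \<and> snd p \<notin> \<Union>M1)"
    if e: "e \<in> edges G" for e
  proof -
    obtain u v where uv: "e = {u, v}"
      using G e by (auto simp: simple_graph_def card_2_iff)
    have "\<not> e \<subseteq> \<Union>M1" "\<not> e \<subseteq> \<Union>M2" if "e \<notin> M1 \<union> M2"
      using ind that e by (auto simp: induced_matching_def induced_subgraph_def)
    moreover have "\<Union>M1 \<inter> \<Union>M2 = {}"
    proof -
      have "e \<inter> f = {}" if "e \<in> M1" "f \<in> M2" for e f
      proof -
        have "e \<noteq> f" using M(2) that by blast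
        then show ?thesis using M(1) that by (simp add: is_matching_def)
      qed
      then show ?thesis by blast
    qed
    ultimately have "e \<notin> M1 \<union> M2 \<longrightarrow>
        u \<notin> \<Union>M2 \<and> v \<notin> \<Union>M1 \<or> v \<notin> \<Union>M2 \<and> u \<notin> \<Union>M1"
      unfolding uv by blast
    then consider "e \<notin> M1 \<union> M2 \<longrightarrow> u \<notin> \<Union>M2 \<and> v \<notin> \<Union>M1"
      | "e \<notin> M1 \<union> M2 \<longrightarrow> v \<notin> \<Union>M2 \<and> u \<notin> \<Union>M1"
      by blast
    then show ?thesis
    proof cases
      case 1
      then show ?thesis by (intro exI[of _ "(u, v)"]) (simp add: uv)
    next
      case 2
      then show ?thesis by (intro exI[of _ "(v, u)"]) (simp add: uv insert_commute)
    qed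
  qed
  then obtain p where "\<forall>e \<in> edges G. {fst (p e), snd (p e)} = e \<and>
      (e \<notin> M1 \<union> M2 \<longrightarrow> fst (p e) \<notin> \<Union>M2 \<and> snd (p e) \<notin> \<Union>M1)"
    by (rule bchoice[OF ballI, THEN exE])
  then show ?thesis
    by (intro exI[of _ "\<lambda>e. fst (p e)"] exI[of _ "\<lambda>e. snd (p e)"])
qed

theorem theorem5p11:
  fixes G :: "'a graph" and k :: nat
  assumes "simple_graph G" and "k > 0" and "k mod 4 = 2"
  shows "real (super_domination_number (subdivision k G)) =
    real k / 2 * real (num_edges G) + real (num_verts G) - real (II_matching_number G)"
proof -
  let ?S = "subdivision k G"
  let ?c = "k div 2 * num_edges G + II_matching_number G"
  have "II_matching_number G \<in> card ` {M. II_matching G M}"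
    unfolding II_matching_number_def using II_matching_number_welldefined[OF assms(1)]
    by (intro Max_in) auto
  then obtain M1 M2 where M: "is_matching G (M1 \<union> M2)" "M1 \<inter> M2 = {}"
    "induced_matching G M1" "induced_matching G M2" "card (M1 \<union> M2) = II_matching_number G"
    by (auto simp: II_matching_def)
  obtain a b where ab: "\<forall>e \<in> edges G. {a e, b e} = e \<and>
    (e \<notin> M1 \<union> M2 \<longrightarrow> a e \<notin> \<Union>M2 \<and> b e \<notin> \<Union>M1)"
    using ex_orientation[OF assms(1) M(1-4)] by blast
  interpret oriented_graph G k a b
    by (rule oriented_graph.intro[OF assms(1,2) conjunct1[OF bspec[OF ab]]])
  have finS: "finite (verts ?S)"
    using simple_graph_subdivision[OF assms(1), of k] by (simp add: simple_graph_def)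
  \<comment> \<open>The total is fixed, so minimising \<open>D\<close> means maximising its
    complement, whose largest size is \<open>?c\<close>.\<close>
  have card_eq: "card D + card (verts ?S - D) = num_verts G + k * num_edges G"
    if "super_dominating_set ?S D" for D
  proof -
    have "D \<subseteq> verts ?S"
      using that by (simp add: super_dominating_set_def dominating_set_def)
    then show ?thesis
      using card_verts_S card_Un_disjoint[of D "verts ?S - D"] finS
      by (simp add: finite_subset Un_absorb1)
  qed
  obtain D where D: "super_dominating_set ?S D" "card (verts ?S - D) = ?c"
    using ex_super_dominating[OF assms(3) M(1,2)] ab M(5) by auto
  have "super_domination_number ?S = card D"
    unfolding super_domination_number_def
  proof (rule Min_eqI)
    show "finite (card ` {D. super_dominating_set ?S D})"
      using super_domination_number_welldefined(1)[OF simple_graph_subdivision[OF assms(1)]] by blast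
    show "card D \<in> card ` {D. super_dominating_set ?S D}"
      using D(1) by blast
    fix n assume "n \<in> card ` {D. super_dominating_set ?S D}"
    then obtain D' where D': "super_dominating_set ?S D'" "n = card D'"
      by blast
    show "card D \<le> n"
      using card_eq[OF D(1)] card_eq[OF D'(1)] super_dominating_compl_le[OF D'(1) assms(3)] D(2) D'(2)
      by linarith
  qed
  moreover have "card D + ?c = num_verts G + k * num_edges G"
    using card_eq[OF D(1)] D(2) by simp
  moreover obtain r where r: "k = 2 * r"
  proof
    show "k = 2 * (k div 2)" using assms(3) by presburger
  qed
  ultimately have "super_domination_number ?S + (r * num_edges G + II_matching_number G) =
      num_verts G + 2 * r * num_edges G"
    by simp
  then have "super_domination_number ?S + II_matching_number G = num_verts G + r * num_edges G"
    by (simp add: mult.assoc)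
  then have "real (super_domination_number ?S) + real (II_matching_number G) =
      real (num_verts G) + real r * real (num_edges G)"
    by (metis of_nat_add of_nat_mult)
  then show ?thesis
    by (simp add: r)
qed

end
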